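(* Let $(\mathcal K,r_n,\xi)$ be a Cayley extender with voltage group $G$. Suppose that $\Gamma(\mathcal K_{r_n})=\Gamma(\mathcal K)$ and that every automorphism of $\mathcal K$ induces an automorphism of $G$, i.e. for every $\tau\in\Gamma(\mathcal K)$ there is a group automorphism $\hat\tau$ of $G$ with $\hat\tau(\xi(F))=\xi(F\tau)$ for every facet $F$ of $\mathcal K$. Then $\mathcal K_{r_n}^\xi$ is hereditary, $\Gamma(\mathcal K_{r_n}^\xi)$ is a semidirect product $G\rtimes\Gamma(\mathcal K)$, and the symmetry type graph of $\mathcal K_{r_n}^\xi$ is $\mathcal K_{r_n}/\Gamma(\mathcal K)$.
   Context: An $n$-premaniplex is a graph (semi-edges and parallel edges allowed) whose vertices, called flags, carry a proper edge colouring with colours $0,\dots,n-1$, each flag $\Phi$ having exactly one incident dart of each colour $i$, with other end $r_i\Phi$; one requires $r_ir_jr_ir_j=1$ for $|i-j|>1$. An $n$-maniplex is a connected $n$-premaniplex in which $r_i$ and $r_ir_j$ ($i\neq j$) have no fixed points. Facets are components after deleting colour-$(n-1)$ edges. Automorphisms are colour-preserving graph automorphisms acting on the right; $\Gamma(\cdot)$ is the automorphism group. The symmetry type graph of $\mathcal M$ is $\mathcal M/\Gamma(\mathcal M)$ (vertices: flag orbits; orbit of $\Phi$ is $i$-adjacent to orbit of $r_i\Phi$). A maniplex is hereditary if every automorphism of each facet extends to an automorphism of the whole maniplex fixing that facet. A Cayley extender is a triple $(\mathcal K,r_n,\xi)$: $\mathcal K$ an $n$-maniplex; $r_n$ a permutation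 of its flags with $r_n^2=1$ commuting with $r_0,\dots,r_{n-2}$; $\xi$ a function from facets of $\mathcal K$ to a group $G$ with $\xi(r_n(F))=\xi(F)^{-1}$; it is assumed $\{\xi(F)\}$ generates $G$ and $\xi(F)\ne1$ whenever $r_n|_F=\mathrm{id}$ or $r_n\Phi=r_i\Phi$ for some flag $\Phi\in F$, $i<n$. The pre-extension $\mathcal K_{r_n}$ is the $(n+1)$-premaniplex with the flags and $i$-adjacencies ($i<n$) of $\mathcal K$ and $n$-adjacency $\Phi\mapsto r_n\Phi$; thus $\Gamma(\mathcal K_{r_n})$ consists of the automorphisms of $\mathcal K$ commuting with $r_n$. The derived maniplex $\mathcal K_{r_n}^\xi$ has flags $(\Phi,\gamma)$, $\gamma\in G$, with $(\Phi,\gamma)$ $i$-adjacent to $(r_i\Phi,\gamma)$ for $i<n$ and $n$-adjacent to $(r_n\Phi,\xi(F)\gamma)$, $F$ the facet of $\Phi$. For a subgroup $H\le\Gamma(\mathcal K)$ (here $H=\Gamma(\mathcal K)=\Gamma(\mathcal K_{r_n})$), $\mathcal K_{r_n}/H$ is the quotient premaniplex with vertices the orbits $\Phi H$ and $\Phi H$ $i$-adjacent to $(r_i\Phi)H$ for $0\le i\le n$. *)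

theory Defs
  imports "HOL-Algebra.Bij" "HOL-Algebra.Generated_Groups"
begin

section \<open>Premaniplexes and maniplexes\<close>

text \<open>
  A properly edge-coloured graph in which every vertex has exactly one dart of each colour is the
  same thing as a vertex set with one involution per colour: \<open>adj M i \<Phi>\<close> is the other end of the
  \<open>i\<close>-dart at \<open>\<Phi>\<close>. A fixed point of \<open>adj M i\<close> is a semi-edge, and a flag at which
  \<open>adj M i\<close> and \<open>adj M j\<close> agree is the end of parallel edges. The record does not contain the rank
  \<open>n\<close>; in rank \<open>n\<close> only the values of \<open>adj M i\<close> for \<open>i < n\<close> on \<open>flags M\<close> are meaningful.
\<close>

record 'f flag_graph =
  flags :: "'f set"
  adj :: "nat \<Rightarrow> 'f \<Rightarrow> 'f"

locale premaniplex =
  fixes n :: nat and M :: "'f flag_graph"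
  assumes adj_closed: "\<lbrakk>i < n; \<Phi> \<in> flags M\<rbrakk> \<Longrightarrow> adj M i \<Phi> \<in> flags M"
    and adj_invol: "\<lbrakk>i < n; \<Phi> \<in> flags M\<rbrakk> \<Longrightarrow> adj M i (adj M i \<Phi>) = \<Phi>"
    and adj_far: "\<lbrakk>i < n; j < n; \<bar>int i - int j\<bar> > 1; \<Phi> \<in> flags M\<rbrakk>
      \<Longrightarrow> adj M i (adj M j (adj M i (adj M j \<Phi>))) = \<Phi>"

definition adj_rel :: "nat set \<Rightarrow> 'f flag_graph \<Rightarrow> 'f rel"
  where "adj_rel I M = {(\<Phi>, adj M i \<Phi>) |\<Phi> i. \<Phi> \<in> flags M \<and> i \<in> I}"

definition component_of :: "nat set \<Rightarrow> 'f flag_graph \<Rightarrow> 'f \<Rightarrow> 'f set"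
  where "component_of I M \<Phi> = (adj_rel I M)\<^sup>* `` {\<Phi>}"

locale maniplex = premaniplex +
  assumes nonempty: "flags M \<noteq> {}"
    and connected: "\<Phi> \<in> flags M \<Longrightarrow> component_of {..<n} M \<Phi> = flags M"
    and adj_neq: "\<lbrakk>i < n; \<Phi> \<in> flags M\<rbrakk> \<Longrightarrow> adj M i \<Phi> \<noteq> \<Phi>"
    and adj_adj_neq: "\<lbrakk>i < n; j < n; i \<noteq> j; \<Phi> \<in> flags M\<rbrakk> \<Longrightarrow> adj M i (adj M j \<Phi>) \<noteq> \<Phi>"

text \<open>Facets are represented by their sets of flags.\<close>

definition facet_of :: "nat \<Rightarrow> 'f flag_graph \<Rightarrow> 'f \<Rightarrow> 'f set"
  where "facet_of n M \<Phi> = component_of ({..<n} - {n - 1}) M \<Phi>"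

definition facets :: "nat \<Rightarrow> 'f flag_graph \<Rightarrow> 'f set set"
  where "facets n M = facet_of n M ` flags M"


section \<open>Isomorphisms, automorphism groups and quotients\<close>

definition fg_iso :: "nat \<Rightarrow> 'f flag_graph \<Rightarrow> 'h flag_graph \<Rightarrow> ('f \<Rightarrow> 'h) set"
  where "fg_iso n M N = {f. bij_betw f (flags M) (flags N) \<and>
    (\<forall>i<n. \<forall>\<Phi>\<in>flags M. f (adj M i \<Phi>) = adj N i (f \<Phi>))}"

text \<open>
  Automorphisms act on the right, so the product of \<open>\<sigma>\<close> and \<open>\<tau>\<close> applies \<open>\<sigma>\<close> first; this is the
  opposite of the convention of \<^const>\<open>BijGroup\<close>. They are taken extensional, so that an automorphism
  is determined by its values on flags.
\<close>

definition aut_group :: "nat \<Rightarrow> 'f flag_graph \<Rightarrow> ('f \<Rightarrow> 'f) monoid"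
  where "aut_group n M =
    \<lparr>carrier = fg_iso n M M \<inter> extensional (flags M),
     mult = (\<lambda>\<sigma> \<tau>. compose (flags M) \<tau> \<sigma>),
     one = (\<lambda>\<Phi>\<in>flags M. \<Phi>)\<rparr>"

definition orbit_of :: "('f \<Rightarrow> 'f) set \<Rightarrow> 'f \<Rightarrow> 'f set"
  where "orbit_of H \<Phi> = (\<lambda>\<tau>. \<tau> \<Phi>) ` H"

text \<open>
  If \<open>H\<close> consists of automorphisms, the orbit of \<open>adj M i \<Phi>\<close> is the same for all \<open>\<Phi>\<close> in an
  orbit \<open>X\<close>, so that the union below is over copies of one and the same orbit.
\<close>

definition quotient_fg :: "'f flag_graph \<Rightarrow> ('f \<Rightarrow> 'f) set \<Rightarrow> 'f set flag_graph"
  where "quotient_fg M H =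
    \<lparr>flags = orbit_of H ` flags M,
     adj = (\<lambda>i X. \<Union>\<Phi>\<in>X. orbit_of H (adj M i \<Phi>))\<rparr>"

definition symmetry_type_graph :: "nat \<Rightarrow> 'f flag_graph \<Rightarrow> 'f set flag_graph"
  where "symmetry_type_graph n M = quotient_fg M (carrier (aut_group n M))"

definition hereditary :: "nat \<Rightarrow> 'f flag_graph \<Rightarrow> bool"
  where "hereditary n M \<longleftrightarrow> maniplex n M \<and>
    (\<forall>F\<in>facets n M. \<forall>\<sigma>\<in>carrier (aut_group (n - 1) (M\<lparr>flags := F\<rparr>)).
      \<exists>\<tau>\<in>carrier (aut_group n M). \<tau> ` F = F \<and> (\<forall>\<Phi>\<in>F. \<tau> \<Phi> = \<sigma> \<Phi>))"


section \<open>Cayley extenders and derived maniplexes\<close>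

locale cayley_extender = maniplex n K + G: group G
  for n :: nat and K :: "'f flag_graph" and rn :: "'f \<Rightarrow> 'f"
    and G :: "('g, 'b) monoid_scheme" (structure) and \<xi> :: "'f set \<Rightarrow> 'g" +
  assumes rn_bij: "bij_betw rn (flags K) (flags K)"
    and rn_invol: "\<Phi> \<in> flags K \<Longrightarrow> rn (rn \<Phi>) = \<Phi>"
    and rn_comm: "\<lbrakk>i < n - 1; \<Phi> \<in> flags K\<rbrakk> \<Longrightarrow> rn (adj K i \<Phi>) = adj K i (rn \<Phi>)"
    and xi_closed: "F \<in> facets n K \<Longrightarrow> \<xi> F \<in> carrier G"
    and xi_inv: "F \<in> facets n K \<Longrightarrow> \<xi> (rn ` F) = inv (\<xi> F)"
    and xi_generate: "generate G (\<xi> ` facets n K) = carrier G"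
    and xi_neq_one: "\<lbrakk>F \<in> facets n K;
        (\<forall>\<Phi>\<in>F. rn \<Phi> = \<Phi>) \<or> (\<exists>\<Phi>\<in>F. \<exists>i<n. rn \<Phi> = adj K i \<Phi>)\<rbrakk> \<Longrightarrow> \<xi> F \<noteq> \<one>"

text \<open>Both of the following have rank \<open>n + 1\<close>.\<close>

definition pre_extension :: "nat \<Rightarrow> 'f flag_graph \<Rightarrow> ('f \<Rightarrow> 'f) \<Rightarrow> 'f flag_graph"
  where "pre_extension n K rn = \<lparr>flags = flags K, adj = (adj K)(n := rn)\<rparr>"

definition derived_maniplex ::
    "nat \<Rightarrow> 'f flag_graph \<Rightarrow> ('f \<Rightarrow> 'f) \<Rightarrow> ('g, 'b) monoid_scheme \<Rightarrow> ('f set \<Rightarrow> 'g)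
      \<Rightarrow> ('f \<times> 'g) flag_graph"
  where "derived_maniplex n K rn G \<xi> =
    \<lparr>flags = flags K \<times> carrier G,
     adj = (\<lambda>i (\<Phi>, \<gamma>). if i = n then (rn \<Phi>, \<xi> (facet_of n K \<Phi>) \<otimes>\<^bsub>G\<^esub> \<gamma>) else (adj K i \<Phi>, \<gamma>))\<rparr>"


section \<open>Semidirect products of groups\<close>

text \<open>
  Here \<open>\<phi>\<close> is a left action of \<open>H\<close> on \<open>G\<close>: the product is a group if \<open>G\<close> and \<open>H\<close> are groups and
  \<open>\<phi> \<in> hom H (AutoGroup G)\<close>, where \<^const>\<open>AutoGroup\<close> multiplies by composing from right to left.
\<close>

definition semidirect_product ::
    "('a, 'm) monoid_scheme \<Rightarrow> ('b, 'l) monoid_scheme \<Rightarrow> ('b \<Rightarrow> 'a \<Rightarrow> 'a) \<Rightarrow> ('a \<times> 'b) monoid"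
  where "semidirect_product G H \<phi> =
    \<lparr>carrier = carrier G \<times> carrier H,
     mult = (\<lambda>(a, h) (b, k). (a \<otimes>\<^bsub>G\<^esub> \<phi> h b, h \<otimes>\<^bsub>H\<^esub> k)),
     one = (\<one>\<^bsub>G\<^esub>, \<one>\<^bsub>H\<^esub>)\<rparr>"

end

theory Submission
  imports Defs
begin

text \<open>
  The facets of the derived maniplex are the copies \<open>flags K \<times> {\<gamma>}\<close> of \<open>K\<close>, so an automorphism maps
  \<open>flags K \<times> {\<one>}\<close> to some other copy by an automorphism \<open>\<tau>\<close> of \<open>K\<close>. Conversely, for \<open>a \<in> G\<close> and
  \<open>\<tau>\<close> inducing \<open>\<theta>\<close> on \<open>G\<close>, the map \<open>(\<Phi>, \<gamma>) \<mapsto> (\<tau> \<Phi>, \<theta> (\<gamma> a))\<close> is an automorphism of the derived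
  maniplex, because \<open>\<tau>\<close> commutes with \<open>r\<^sub>n\<close>; a suitable \<open>a\<close> makes it send a given facet to any
  other one. Automorphisms of a connected graph that agree at a flag are equal, so there are no further
  automorphisms, and the orbit of \<open>(\<Phi>, \<gamma>)\<close> is the orbit of \<open>\<Phi>\<close> times \<open>G\<close>.
\<close>

section \<open>Components and facets\<close>

lemma component_of_refl: "\<Phi> \<in> component_of I M \<Phi>"
  by (simp add: component_of_def)

lemma component_of_step:
  "\<lbrakk>\<Psi> \<in> component_of I M \<Phi>; \<Psi> \<in> flags M; i \<in> I\<rbrakk> \<Longrightarrow> adj M i \<Psi> \<in> component_of I M \<Phi>"
  by (auto simp: component_of_def adj_rel_def intro: rtrancl_into_rtrancl)

lemma component_of_mono: "\<Psi> \<in> component_of I M \<Phi> \<Longrightarrow> component_of I M \<Psi> \<subseteq> component_of I M \<Phi>"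
  by (auto simp: component_of_def)

lemma component_of_induct [consumes 1, case_names start step]:
  assumes "\<Psi> \<in> component_of I M \<Phi>"
    and "P \<Phi>"
    and "\<And>\<Psi> i. \<lbrakk>\<Psi> \<in> component_of I M \<Phi>; \<Psi> \<in> flags M; i \<in> I; P \<Psi>\<rbrakk> \<Longrightarrow> P (adj M i \<Psi>)"
  shows "P \<Psi>"
proof -
  have "(\<Phi>, \<Psi>) \<in> (adj_rel I M)\<^sup>*"
    using assms(1) by (simp add: component_of_def)
  then show ?thesis
  proof (induction rule: rtrancl_induct)
    case base
    show ?case by fact
  next
    case (step \<Psi> \<Psi>')
    then show ?case
      using assms(3)[of \<Psi>] by (auto simp: component_of_def adj_rel_def)
  qed
qed

lemma component_of_subset_flags:
  assumes "\<And>\<Phi> i. \<lbrakk>\<Phi> \<in> flags M; i \<in> I\<rbrakk> \<Longrightarrow> adj M i \<Phi> \<in> flags M"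
    and "\<Phi> \<in> flags M"
  shows "component_of I M \<Phi> \<subseteq> flags M"
proof
  fix \<Psi>
  assume "\<Psi> \<in> component_of I M \<Phi>"
  then show "\<Psi> \<in> flags M"
    by (induction rule: component_of_induct) (auto simp: assms)
qed

text \<open>Colour-preserving maps carry paths to paths, and a path in \<open>N\<close> starting at
  \<open>f \<Phi>\<close> lifts one edge at a time. This handles facets under automorphisms and
  under \<open>rn\<close>, as well as the copies of \<open>K\<close> in the derived
  maniplex.\<close>

lemma component_of_image:
  assumes closed: "\<And>\<Phi> i. \<lbrakk>\<Phi> \<in> flags M; i \<in> I\<rbrakk> \<Longrightarrow> adj M i \<Phi> \<in> flags M"
    and f_closed: "f \<in> flags M \<rightarrow> flags N"
    and f_adj: "\<And>\<Phi> i. \<lbrakk>\<Phi> \<in> flags M; i \<in> I\<rbrakk> \<Longrightarrow> f (adj M i \<Phi>) = adj N i (f \<Phi>)"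
    and \<Phi>: "\<Phi> \<in> flags M"
  shows "f ` component_of I M \<Phi> = component_of I N (f \<Phi>)"
proof
  show "f ` component_of I M \<Phi> \<subseteq> component_of I N (f \<Phi>)"
  proof clarify
    fix \<Psi>
    assume "\<Psi> \<in> component_of I M \<Phi>"
    then show "f \<Psi> \<in> component_of I N (f \<Phi>)"
    proof (induction rule: component_of_induct)
      case start
      show ?case by (rule component_of_refl)
    next
      case (step \<Psi> i)
      then show ?case
        using f_closed by (auto simp: f_adj intro: component_of_step)
    qed
  qed
next
  show "component_of I N (f \<Phi>) \<subseteq> f ` component_of I M \<Phi>"
  proof
    fix X
    assume "X \<in> component_of I N (f \<Phi>)"
    then show "X \<in> f ` component_of I M \<Phi>"
    proof (induction rule: component_of_induct)
      case start
      show ?case by (simp add: component_of_refl)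
    next
      case (step X i)
      then obtain \<Psi> where \<Psi>: "\<Psi> \<in> component_of I M \<Phi>" "X = f \<Psi>"
        by blast
      moreover have "\<Psi> \<in> flags M"
        using \<Psi>(1) component_of_subset_flags[of M I, OF closed \<Phi>] by blast
      ultimately show ?case
        using step.hyps component_of_step[of \<Psi> I M \<Phi> i] by (auto simp flip: f_adj)
    qed
  qed
qed

text \<open>The value at one flag propagates along edges. This later forces an automorphism to equal
  a lift as soon as they agree at a single flag.\<close>

lemma component_of_agree:
  assumes "\<Psi> \<in> component_of I M \<Phi>"
    and "f \<Phi> = g \<Phi>"
    and "\<And>\<Phi> i. \<lbrakk>\<Phi> \<in> flags M; i \<in> I\<rbrakk> \<Longrightarrow> f (adj M i \<Phi>) = adj N i (f \<Phi>)"
    and "\<And>\<Phi> i. \<lbrakk>\<Phi> \<in> flags M; i \<in> I\<rbrakk> \<Longrightarrow> g (adj M i \<Phi>) = adj N i (g \<Phi>)"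
  shows "f \<Psi> = g \<Psi>"
  using assms(1) by (induction rule: component_of_induct) (simp_all add: assms)

text \<open>Truncated subtraction makes both colour sets empty for \<open>n = 0\<close>, so every
  rank is covered. In rank \<open>n + 1\<close> facets become components for the colours in
  \<open>{..<n}\<close>.\<close>

lemma facet_of_eq_component: "facet_of n M \<Phi> = component_of {..<n - 1} M \<Phi>"
proof -
  have "{..<n} - {n - 1} = {..<n - 1}"
    by auto
  then show ?thesis
    by (simp only: facet_of_def)
qed

context premaniplex
begin

lemma facet_of_subset_flags: "\<Phi> \<in> flags M \<Longrightarrow> facet_of n M \<Phi> \<subseteq> flags M"
  unfolding facet_of_eq_component by (rule component_of_subset_flags) (auto simp: adj_closed)

lemma facet_of_adj:
  assumes i: "i < n - 1" and \<Phi>: "\<Phi> \<in> flags M"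
  shows "facet_of n M (adj M i \<Phi>) = facet_of n M \<Phi>"
proof -
  \<comment> \<open>One inclusion at every flag is enough: taken at \<open>adj M i \<Phi>\<close>,
    it becomes the reverse inclusion because \<open>adj M i\<close> is an involution.\<close>
  have sub: "facet_of n M (adj M i \<Psi>) \<subseteq> facet_of n M \<Psi>" if "\<Psi> \<in> flags M" for \<Psi>
    unfolding facet_of_eq_component using i that
    by (intro component_of_mono component_of_step component_of_refl) auto
  have "i < n"
    using i by simp
  then show ?thesis
    using sub[OF \<Phi>] sub[OF adj_closed[OF _ \<Phi>], of i] by (simp add: adj_invol \<Phi>)
qed

text \<open>Only colours below \<open>n - 1\<close> have to be preserved, so this applies to
  \<open>rn\<close> as well as to automorphisms.\<close>

lemma facet_of_image:
  assumes "f \<in> flags M \<rightarrow> flags M"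
    and "\<And>\<Phi> i. \<lbrakk>\<Phi> \<in> flags M; i < n - 1\<rbrakk> \<Longrightarrow> f (adj M i \<Phi>) = adj M i (f \<Phi>)"
    and "\<Phi> \<in> flags M"
  shows "facet_of n M (f \<Phi>) = f ` facet_of n M \<Phi>"
  unfolding facet_of_eq_component
  by (rule component_of_image[symmetric]) (use assms adj_closed in auto)

end


section \<open>Automorphisms\<close>

lemma aut_group_bij: "\<tau> \<in> carrier (aut_group n M) \<Longrightarrow> bij_betw \<tau> (flags M) (flags M)"
  by (simp add: aut_group_def fg_iso_def)

lemma aut_group_closed: "\<lbrakk>\<tau> \<in> carrier (aut_group n M); \<Phi> \<in> flags M\<rbrakk> \<Longrightarrow> \<tau> \<Phi> \<in> flags M"
  using aut_group_bij bij_betwE by blast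

lemma aut_group_adj:
  "\<lbrakk>\<tau> \<in> carrier (aut_group n M); i < n; \<Phi> \<in> flags M\<rbrakk> \<Longrightarrow> \<tau> (adj M i \<Phi>) = adj M i (\<tau> \<Phi>)"
  by (simp add: aut_group_def fg_iso_def)

lemma aut_group_extensional: "\<tau> \<in> carrier (aut_group n M) \<Longrightarrow> \<tau> \<in> extensional (flags M)"
  by (simp add: aut_group_def)

lemma aut_groupI:
  assumes "bij_betw \<tau> (flags M) (flags M)"
    and "\<And>i \<Phi>. \<lbrakk>i < n; \<Phi> \<in> flags M\<rbrakk> \<Longrightarrow> \<tau> (adj M i \<Phi>) = adj M i (\<tau> \<Phi>)"
    and "\<tau> \<in> extensional (flags M)"
  shows "\<tau> \<in> carrier (aut_group n M)"
  using assms by (simp add: aut_group_def fg_iso_def)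

lemma aut_group_mult: "\<sigma> \<otimes>\<^bsub>aut_group n M\<^esub> \<tau> = compose (flags M) \<tau> \<sigma>"
  by (simp add: aut_group_def)

lemma aut_group_mult_closed:
  assumes "\<sigma> \<in> carrier (aut_group n M)" "\<tau> \<in> carrier (aut_group n M)"
    and "\<And>i \<Phi>. \<lbrakk>i < n; \<Phi> \<in> flags M\<rbrakk> \<Longrightarrow> adj M i \<Phi> \<in> flags M"
  shows "\<sigma> \<otimes>\<^bsub>aut_group n M\<^esub> \<tau> \<in> carrier (aut_group n M)"
  unfolding aut_group_mult using assms
  by (intro aut_groupI bij_betw_compose[of _ _ "flags M"])
    (auto simp: compose_def aut_group_bij aut_group_adj aut_group_closed)

text \<open>Intended for \<open>H\<close> a semidirect product that is mapped onto an automorphism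
  group \<open>G\<close>. Closure of \<open>H\<close> is what allows the homomorphism law to be
  pulled back along the inverse of \<open>h\<close>.\<close>

lemma is_iso_by_inverse:
  assumes bij: "bij_betw h (carrier H) (carrier G)"
    and closed: "\<And>x y. \<lbrakk>x \<in> carrier H; y \<in> carrier H\<rbrakk> \<Longrightarrow> x \<otimes>\<^bsub>H\<^esub> y \<in> carrier H"
    and mult: "\<And>x y. \<lbrakk>x \<in> carrier H; y \<in> carrier H\<rbrakk> \<Longrightarrow> h (x \<otimes>\<^bsub>H\<^esub> y) = h x \<otimes>\<^bsub>G\<^esub> h y"
  shows "G \<cong> H"
proof (rule is_isoI[OF isoI])
  let ?k = "inv_into (carrier H) h"
  show bij_k: "bij_betw ?k (carrier G) (carrier H)"
    by (rule bij_betw_inv_into[OF bij])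
  show "?k \<in> hom G H"
  proof (rule homI)
    fix x y
    assume xy: "x \<in> carrier G" "y \<in> carrier G"
    then have k: "?k x \<in> carrier H" "?k y \<in> carrier H"
      using bij_k bij_betwE by blast+
    have "x \<otimes>\<^bsub>G\<^esub> y = h (?k x \<otimes>\<^bsub>H\<^esub> ?k y)"
      using xy by (simp add: mult k bij_betw_inv_into_right[OF bij])
    then show "?k (x \<otimes>\<^bsub>G\<^esub> y) = ?k x \<otimes>\<^bsub>H\<^esub> ?k y"
      by (simp add: closed k bij_betw_inv_into_left[OF bij])
  qed (use bij_k bij_betwE in blast)
qed

section \<open>Automorphisms of a group and homomorphisms on generators\<close>

lemma carrier_AutoGroup [simp]: "carrier (AutoGroup G) = auto G"
  by (simp add: AutoGroup_def)

lemma AutoGroup_mult: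
  "\<lbrakk>f \<in> auto G; g \<in> auto G\<rbrakk> \<Longrightarrow> f \<otimes>\<^bsub>AutoGroup G\<^esub> g = compose (carrier G) f g"
  by (simp add: AutoGroup_def BijGroup_def auto_def)

lemma AutoGroup_one: "\<one>\<^bsub>AutoGroup G\<^esub> = (\<lambda>x\<in>carrier G. x)"
  by (simp add: AutoGroup_def BijGroup_def)

lemma (in group) mult_neq_self:
  "\<lbrakk>x \<in> carrier G; y \<in> carrier G; x \<noteq> \<one>\<rbrakk> \<Longrightarrow> x \<otimes> y \<noteq> y"
  using r_cancel_one' by auto

text \<open>Agreement passes from generators to inverses and products. With the voltages as
  generators it compares automorphisms of the voltage group.\<close>

lemma (in group) hom_eq_on_generate:
  assumes "h \<in> hom G H" "k \<in> hom G H" "group H"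
    and "S \<subseteq> carrier G" and "\<And>x. x \<in> S \<Longrightarrow> h x = k x"
    and "x \<in> generate G S"
  shows "h x = k x"
  using assms(6)
proof induction
  case one
  show ?case
    using assms(1-3) by (simp add: hom_one[OF _ is_group])
next
  case (incl x)
  then show ?case by (rule assms(5))
next
  case (inv x)
  then have "x \<in> carrier G"
    using assms(4) by blast
  then have "h (inv x) = inv\<^bsub>H\<^esub> h x" "k (inv x) = inv\<^bsub>H\<^esub> k x"
    using assms(1-3) group_hom.hom_inv[of G H] is_group
    by (auto simp: group_hom_def group_hom_axioms_def)
  then show ?case
    using inv assms(5) by simp
next
  case (eng x y)
  then have "x \<in> carrier G" "y \<in> carrier G"
    using generate_in_carrier[OF assms(4)] by blast+
  then show ?case
    using assms(1,2) eng by (simp add: hom_mult)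
qed


section \<open>The derived maniplex\<close>

context cayley_extender
begin

abbreviation derived :: "('f \<times> 'g) flag_graph"
  where "derived \<equiv> derived_maniplex n K rn G \<xi>"

lemma flags_derived [simp]: "flags derived = flags K \<times> carrier G"
  by (simp add: derived_maniplex_def)

lemma adj_derived [simp]: "i < n \<Longrightarrow> adj derived i (\<Phi>, \<gamma>) = (adj K i \<Phi>, \<gamma>)"
  by (simp add: derived_maniplex_def)

lemma adj_derived_n [simp]: "adj derived n (\<Phi>, \<gamma>) = (rn \<Phi>, \<xi> (facet_of n K \<Phi>) \<otimes> \<gamma>)"
  by (simp add: derived_maniplex_def)

lemma rn_closed: "\<Phi> \<in> flags K \<Longrightarrow> rn \<Phi> \<in> flags K"
  using rn_bij bij_betwE by blast

lemma facet_of_in_facets: "\<Phi> \<in> flags K \<Longrightarrow> facet_of n K \<Phi> \<in> facets n K"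
  by (simp add: facets_def)

lemma facet_of_rn: "\<Phi> \<in> flags K \<Longrightarrow> facet_of n K (rn \<Phi>) = rn ` facet_of n K \<Phi>"
  by (rule facet_of_image) (auto simp: rn_closed rn_comm)

lemma xi_facet_closed: "\<Phi> \<in> flags K \<Longrightarrow> \<xi> (facet_of n K \<Phi>) \<in> carrier G"
  by (simp add: facet_of_in_facets xi_closed)

lemma xi_facet_rn: "\<Phi> \<in> flags K \<Longrightarrow> \<xi> (facet_of n K (rn \<Phi>)) = inv \<xi> (facet_of n K \<Phi>)"
  by (simp add: facet_of_rn facet_of_in_facets xi_inv)

text \<open>\<open>rn\<close> commutes with the colours below \<open>n - 1\<close>, so a single
  fixed flag makes \<open>rn\<close> fix the whole facet pointwise.\<close>

lemma xi_neq_one_fixed: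
  assumes \<Phi>: "\<Phi> \<in> flags K" and fixed: "rn \<Phi> = \<Phi>"
  shows "\<xi> (facet_of n K \<Phi>) \<noteq> \<one>"
proof -
  have "rn \<Psi> = \<Psi>" if "\<Psi> \<in> facet_of n K \<Phi>" for \<Psi>
    using that unfolding facet_of_eq_component
  proof (induction rule: component_of_induct)
    case (step \<Psi> i)
    then show ?case by (simp add: rn_comm)
  qed (rule fixed)
  then show ?thesis
    by (simp add: xi_neq_one facet_of_in_facets \<Phi>)
qed

lemma xi_neq_one_adj:
  assumes "\<Phi> \<in> flags K" "i < n" "rn \<Phi> = adj K i \<Phi>"
  shows "\<xi> (facet_of n K \<Phi>) \<noteq> \<one>"
proof (rule xi_neq_one)
  have "\<Phi> \<in> facet_of n K \<Phi>"
    by (simp add: facet_of_eq_component component_of_refl)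
  with assms show "(\<forall>\<Psi>\<in>facet_of n K \<Phi>. rn \<Psi> = \<Psi>) \<or> (\<exists>\<Psi>\<in>facet_of n K \<Phi>. \<exists>i<n. rn \<Psi> = adj K i \<Psi>)"
    by blast
qed (simp add: facet_of_in_facets assms)

lemma adj_derived_closed:
  "\<lbrakk>i < n + 1; X \<in> flags derived\<rbrakk> \<Longrightarrow> adj derived i X \<in> flags derived"
  by (cases "i = n") (auto simp: adj_closed rn_closed xi_facet_closed less_Suc_eq)

text \<open>For colour \<open>n\<close>, the facets of \<open>\<Phi>\<close> and
  \<open>rn \<Phi>\<close> carry inverse voltages, which cancel.\<close>

lemma adj_derived_invol:
  assumes "i < n + 1" "X \<in> flags derived"
  shows "adj derived i (adj derived i X) = X"
proof (cases "i = n")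
  case True
  then show ?thesis
    using assms
    by (auto simp: rn_invol xi_facet_rn xi_facet_closed simp flip: G.m_assoc)
next
  case False
  then show ?thesis
    using assms by (auto simp: adj_invol)
qed

text \<open>A step of colour \<open>i < n - 1\<close> stays in the same facet of \<open>K\<close>,
  so the voltage picked up along colour \<open>n\<close> does not change.\<close>

lemma adj_derived_comm:
  assumes "i < n - 1" "X \<in> flags derived"
  shows "adj derived n (adj derived i X) = adj derived i (adj derived n X)"
  using assms by (auto simp: rn_comm facet_of_adj)

section \<open>Facets and connectedness of the derived maniplex\<close>

lemma component_derived:
  assumes "\<Phi> \<in> flags K" "\<gamma> \<in> carrier G"
  shows "component_of {..<n} derived (\<Phi>, \<gamma>) = flags K \<times> {\<gamma>}"
proof -
  \<comment> \<open>Colours below \<open>n\<close> leave the group coordinate alone, so pairing with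
    \<open>\<gamma>\<close> embeds \<open>K\<close> as a colour-preserving copy.\<close>
  have "component_of {..<n} derived (\<Phi>, \<gamma>) = (\<lambda>\<Psi>. (\<Psi>, \<gamma>)) ` component_of {..<n} K \<Phi>"
    by (rule component_of_image[symmetric]) (use assms adj_closed in auto)
  then show ?thesis
    using connected[OF assms(1)] by auto
qed

lemma facet_of_derived:
  assumes "\<Phi> \<in> flags K" "\<gamma> \<in> carrier G"
  shows "facet_of (n + 1) derived (\<Phi>, \<gamma>) = flags K \<times> {\<gamma>}"
  using component_derived[OF assms] by (simp add: facet_of_eq_component)

text \<open>Every flag of a copy of \<open>K\<close> is reachable inside that copy, and crossing
  edges of colour \<open>n\<close> multiplies the group coordinate by voltages, which generate
  \<open>G\<close>.\<close>

lemma component_derived_full: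
  assumes \<Phi>: "\<Phi> \<in> flags K" and \<gamma>: "\<gamma> \<in> carrier G"
  shows "component_of {..<n + 1} derived (\<Phi>, \<gamma>) = flags derived" (is "?C = _")
proof
  show "?C \<subseteq> flags derived"
    by (rule component_of_subset_flags) (use adj_derived_closed \<Phi> \<gamma> in auto)
next
  have move: "(\<Psi>', \<delta>) \<in> ?C"
    if "(\<Psi>, \<delta>) \<in> ?C" "\<Psi> \<in> flags K" "\<Psi>' \<in> flags K" "\<delta> \<in> carrier G" for \<Psi> \<Psi>' \<delta>
  proof -
    have "\<Psi>' \<in> component_of {..<n} K \<Psi>"
      using connected that by simp
    then show ?thesis
    proof (induction rule: component_of_induct)
      case (step \<Psi>' i)
      then show ?case
        using component_of_step[of "(\<Psi>', \<delta>)" "{..<n + 1}" derived _ i] that by auto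
    qed fact
  qed
  \<comment> \<open>Move inside the copy to a flag of \<open>F\<close>, cross the edge of colour
    \<open>n\<close> there, and move to \<open>\<Psi>\<close> inside the new copy.\<close>
  have mult_xi: "(\<Psi>, \<xi> F \<otimes> \<delta>) \<in> ?C"
    if C: "(\<Psi>, \<delta>) \<in> ?C" "\<Psi> \<in> flags K" "\<delta> \<in> carrier G" and F: "F \<in> facets n K" for \<Psi> \<delta> F
  proof -
    obtain \<Psi>' where \<Psi>': "\<Psi>' \<in> flags K" "F = facet_of n K \<Psi>'"
      using F by (auto simp: facets_def)
    have "(\<Psi>', \<delta>) \<in> ?C"
      using move C \<Psi>'(1) by blast
    then have "(rn \<Psi>', \<xi> F \<otimes> \<delta>) \<in> ?C"
      using component_of_step[of "(\<Psi>', \<delta>)" "{..<n + 1}" derived _ n] C \<Psi>' by auto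
    then show ?thesis
      by (rule move) (use C \<Psi>' F xi_closed rn_closed in auto)
  qed
  have mult: "(\<Psi>, g \<otimes> \<delta>) \<in> ?C"
    if "g \<in> generate G (\<xi> ` facets n K)" "(\<Psi>, \<delta>) \<in> ?C" "\<Psi> \<in> flags K" "\<delta> \<in> carrier G" for \<Psi> g \<delta>
    using that
  proof (induction arbitrary: \<delta> rule: generate.induct)
    case one
    then show ?case by simp
  next
    case (incl h)
    then show ?case using mult_xi by blast
  next
    case (inv h)
    then obtain F where F: "F \<in> facets n K" "h = \<xi> F"
      by blast
    \<comment> \<open>The inverse of a voltage is again a voltage, that of the image facet under
      \<open>rn\<close>.\<close>
    then have "rn ` F \<in> facets n K"
      by (auto simp: facets_def rn_closed simp flip: facet_of_rn)
    then show ?case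
      using mult_xi[of \<Psi> \<delta> "rn ` F"] inv F by (simp add: xi_inv)
  next
    case (eng g h)
    then show ?case by (simp add: G.m_assoc xi_generate)
  qed
  show "flags derived \<subseteq> ?C"
  proof clarsimp
    fix \<Psi> \<delta>
    assume \<Psi>: "\<Psi> \<in> flags K" "\<delta> \<in> carrier G"
    have "(\<Psi>, \<gamma>) \<in> ?C"
      using move[OF component_of_refl] \<Phi> \<gamma> \<Psi> by blast
    then have "(\<Psi>, (\<delta> \<otimes> inv \<gamma>) \<otimes> \<gamma>) \<in> ?C"
      by (rule mult[rotated]) (use \<gamma> \<Psi> xi_generate in auto)
    then show "(\<Psi>, \<delta>) \<in> component_of {..<Suc n} derived (\<Phi>, \<gamma>)"
      using \<gamma> \<Psi> by (simp add: G.m_assoc)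
  qed
qed

theorem maniplex_derived: "maniplex (n + 1) derived"
proof
  fix i X
  assume i: "i < n + 1" and X: "X \<in> flags derived"
  show "adj derived i X \<in> flags derived"
    using i X by (rule adj_derived_closed)
  show "adj derived i (adj derived i X) = X"
    using i X by (rule adj_derived_invol)
  \<comment> \<open>For \<open>i = n\<close>, a fixed pair would require both that \<open>rn\<close>
    fixes the flag and that the voltage is trivial.\<close>
  show "adj derived i X \<noteq> X"
    using i X G.mult_neq_self xi_neq_one_fixed
    by (cases "i = n") (auto simp: adj_neq xi_facet_closed)
next
  fix i j X
  assume i: "i < n + 1" and j: "j < n + 1" and ij: "\<bar>int i - int j\<bar> > 1" and X: "X \<in> flags derived"
  \<comment> \<open>If one of two distant colours is \<open>n\<close>, the other is below
    \<open>n - 1\<close>; commutation and involutivity then give the relation.\<close>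
  consider "i < n" "j < n" | "i = n" "j < n - 1" | "j = n" "i < n - 1"
    using i j ij by linarith
  then show "adj derived i (adj derived j (adj derived i (adj derived j X))) = X"
  proof cases
    case 1
    then show ?thesis
      using X ij by (auto simp: adj_far)
  next
    case 2
    then show ?thesis
      using X i j by (metis adj_derived_comm adj_derived_closed adj_derived_invol)
  next
    case 3
    then show ?thesis
      using X i j by (metis adj_derived_comm adj_derived_closed adj_derived_invol)
  qed
next
  show "flags derived \<noteq> {}"
    using nonempty G.one_closed by auto
next
  fix X
  assume "X \<in> flags derived"
  then show "component_of {..<n + 1} derived X = flags derived"
    using component_derived_full by auto
next
  fix i j X
  assume i: "i < n + 1" and j: "j < n + 1" and ij: "i \<noteq> j" and X: "X \<in> flags derived"
  obtain \<Phi> \<gamma> where X_eq: "X = (\<Phi>, \<gamma>)" and \<Phi>: "\<Phi> \<in> flags K" and \<gamma>: "\<gamma> \<in> carrier G"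
    using X by auto
  consider "i < n" "j < n" | "i = n" "j < n" | "j = n" "i < n"
    using i j ij by linarith
  then show "adj derived i (adj derived j X) \<noteq> X"
  proof cases
    case 1
    then show ?thesis
      using ij \<Phi> by (simp add: X_eq adj_adj_neq)
  next
    case 2
    \<comment> \<open>A fixed flag here would make colours \<open>n\<close> and \<open>j\<close>
      parallel at \<open>adj K j \<Phi>\<close>; there the voltage is nontrivial and changes the
      group coordinate.\<close>
    have "rn (adj K j \<Phi>) = adj K j (adj K j \<Phi>) \<Longrightarrow> \<xi> (facet_of n K (adj K j \<Phi>)) \<noteq> \<one>"
      using 2 \<Phi> by (intro xi_neq_one_adj) (auto simp: adj_closed)
    then show ?thesis
      using 2 \<Phi> \<gamma> G.mult_neq_self by (auto simp: X_eq adj_invol adj_closed xi_facet_closed)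
  next
    case 3
    \<comment> \<open>In this order the parallel edges would be at \<open>\<Phi>\<close>
      itself.\<close>
    have "rn \<Phi> = adj K i \<Phi>" if "adj K i (rn \<Phi>) = \<Phi>"
      using that adj_invol[of i "rn \<Phi>"] 3 \<Phi> by (simp add: rn_closed)
    then show ?thesis
      using 3 \<Phi> \<gamma> G.mult_neq_self xi_neq_one_adj by (auto simp: X_eq xi_facet_closed)
  qed
qed

end


section \<open>Automorphisms of the derived maniplex\<close>

text \<open>\<open>aut_rn\<close> is the form in which the equality of the automorphism groups of
  \<open>K\<close> and of its pre-extension enters the argument.\<close>

locale symmetric_cayley_extender = cayley_extender n K rn G \<xi>
  for n :: nat and K :: "'f flag_graph" and rn :: "'f \<Rightarrow> 'f"
    and G :: "('g, 'b) monoid_scheme" (structure) and \<xi> :: "'f set \<Rightarrow> 'g" +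
  assumes aut_rn: "\<lbrakk>\<tau> \<in> carrier (aut_group n K); \<Phi> \<in> flags K\<rbrakk> \<Longrightarrow> \<tau> (rn \<Phi>) = rn (\<tau> \<Phi>)"
    and induces: "\<tau> \<in> carrier (aut_group n K) \<Longrightarrow> \<exists>\<theta>\<in>auto G. \<forall>F\<in>facets n K. \<theta> (\<xi> F) = \<xi> (\<tau> ` F)"
begin

section \<open>Automorphisms induced on the voltage group\<close>

definition induced :: "('f \<Rightarrow> 'f) \<Rightarrow> 'g \<Rightarrow> 'g"
  where "induced \<tau> = (SOME \<theta>. \<theta> \<in> auto G \<and> (\<forall>F\<in>facets n K. \<theta> (\<xi> F) = \<xi> (\<tau> ` F)))"

lemma induced_spec:
  assumes "\<tau> \<in> carrier (aut_group n K)"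
  shows "induced \<tau> \<in> auto G \<and> (\<forall>F\<in>facets n K. induced \<tau> (\<xi> F) = \<xi> (\<tau> ` F))"
proof -
  have "\<exists>\<theta>. \<theta> \<in> auto G \<and> (\<forall>F\<in>facets n K. \<theta> (\<xi> F) = \<xi> (\<tau> ` F))"
    using induces[OF assms] by blast
  then show ?thesis
    unfolding induced_def by (rule someI_ex)
qed

lemma induced_auto: "\<tau> \<in> carrier (aut_group n K) \<Longrightarrow> induced \<tau> \<in> auto G"
  using induced_spec by blast

lemma induced_xi:
  "\<lbrakk>\<tau> \<in> carrier (aut_group n K); F \<in> facets n K\<rbrakk> \<Longrightarrow> induced \<tau> (\<xi> F) = \<xi> (\<tau> ` F)"
  using induced_spec by blast

lemma
  assumes "\<tau> \<in> carrier (aut_group n K)"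
  shows induced_hom: "induced \<tau> \<in> hom G G"
    and induced_bij: "bij_betw (induced \<tau>) (carrier G) (carrier G)"
    and induced_extensional: "induced \<tau> \<in> extensional (carrier G)"
  using induced_auto[OF assms] by (auto simp: auto_def Bij_def)

lemma induced_closed:
  "\<lbrakk>\<tau> \<in> carrier (aut_group n K); \<gamma> \<in> carrier G\<rbrakk> \<Longrightarrow> induced \<tau> \<gamma> \<in> carrier G"
  using induced_hom by (rule hom_in_carrier)

lemma facet_of_aut:
  "\<lbrakk>\<tau> \<in> carrier (aut_group n K); \<Phi> \<in> flags K\<rbrakk> \<Longrightarrow> facet_of n K (\<tau> \<Phi>) = \<tau> ` facet_of n K \<Phi>"
  by (rule facet_of_image) (auto simp: aut_group_closed aut_group_adj)

lemma aut_facet_in_facets: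
  "\<lbrakk>\<tau> \<in> carrier (aut_group n K); F \<in> facets n K\<rbrakk> \<Longrightarrow> \<tau> ` F \<in> facets n K"
  by (auto simp: facets_def aut_group_closed simp flip: facet_of_aut)

lemma aut_mult_closed:
  "\<lbrakk>\<sigma> \<in> carrier (aut_group n K); \<tau> \<in> carrier (aut_group n K)\<rbrakk>
    \<Longrightarrow> \<sigma> \<otimes>\<^bsub>aut_group n K\<^esub> \<tau> \<in> carrier (aut_group n K)"
  by (rule aut_group_mult_closed) (auto simp: adj_closed)

text \<open>Both sides agree on the voltages, and these generate \<open>G\<close>; for the same
  reason the choice made in \<open>induced\<close> is forced. The order is reversed because
  \<open>\<sigma>\<close> is applied first in the product.\<close>

lemma induced_mult:
  assumes \<sigma>: "\<sigma> \<in> carrier (aut_group n K)" and \<tau>: "\<tau> \<in> carrier (aut_group n K)"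
    and \<gamma>: "\<gamma> \<in> carrier G"
  shows "induced (\<sigma> \<otimes>\<^bsub>aut_group n K\<^esub> \<tau>) \<gamma> = induced \<tau> (induced \<sigma> \<gamma>)"
proof -
  have "induced (\<sigma> \<otimes>\<^bsub>aut_group n K\<^esub> \<tau>) \<gamma> = (induced \<tau> \<circ> induced \<sigma>) \<gamma>"
  proof (rule G.hom_eq_on_generate[where H = G and S = "\<xi> ` facets n K"
        and h = "induced (\<sigma> \<otimes>\<^bsub>aut_group n K\<^esub> \<tau>)" and k = "induced \<tau> \<circ> induced \<sigma>"])
    show "induced (\<sigma> \<otimes>\<^bsub>aut_group n K\<^esub> \<tau>) \<in> hom G G"
      by (rule induced_hom[OF aut_mult_closed[OF \<sigma> \<tau>]])
    show "induced \<tau> \<circ> induced \<sigma> \<in> hom G G"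
      by (rule hom_compose[OF induced_hom[OF \<sigma>] induced_hom[OF \<tau>]])
    show "\<gamma> \<in> generate G (\<xi> ` facets n K)"
      by (simp add: xi_generate \<gamma>)
    fix x
    assume "x \<in> \<xi> ` facets n K"
    then obtain F where F: "F \<in> facets n K" "x = \<xi> F"
      by blast
    \<comment> \<open>The product of automorphisms is a composition restricted to flags, so its
      image of \<open>F\<close> can be computed only inside \<open>flags K\<close>.\<close>
    then have "F \<subseteq> flags K"
      using facet_of_subset_flags by (auto simp: facets_def)
    then have "(\<sigma> \<otimes>\<^bsub>aut_group n K\<^esub> \<tau>) ` F = \<tau> ` \<sigma> ` F"
      unfolding image_image by (intro image_cong) (auto simp: aut_group_mult compose_eq)
    then show "induced (\<sigma> \<otimes>\<^bsub>aut_group n K\<^esub> \<tau>) x = (induced \<tau> \<circ> induced \<sigma>) x"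
      using F by (simp add: induced_xi \<sigma> \<tau> aut_mult_closed aut_facet_in_facets)
  qed (use xi_closed in auto)
  then show ?thesis by simp
qed

section \<open>Lifting automorphisms to the derived maniplex\<close>

definition lift :: "'g \<Rightarrow> ('f \<Rightarrow> 'f) \<Rightarrow> 'f \<times> 'g \<Rightarrow> 'f \<times> 'g"
  where "lift a \<tau> = (\<lambda>(\<Phi>, \<gamma>)\<in>flags derived. (\<tau> \<Phi>, induced \<tau> (\<gamma> \<otimes> a)))"

lemma lift_apply:
  "\<lbrakk>\<Phi> \<in> flags K; \<gamma> \<in> carrier G\<rbrakk> \<Longrightarrow> lift a \<tau> (\<Phi>, \<gamma>) = (\<tau> \<Phi>, induced \<tau> (\<gamma> \<otimes> a))"
  by (simp add: lift_def)

text \<open>Edges of colour \<open>n\<close> multiply by voltages on the left, which commutes with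
  translation by \<open>a\<close> on the right; \<open>induced \<tau>\<close> then carries the
  voltage of a facet to that of its image.\<close>

lemma lift_aut:
  assumes a: "a \<in> carrier G" and \<tau>: "\<tau> \<in> carrier (aut_group n K)"
  shows "lift a \<tau> \<in> carrier (aut_group (n + 1) derived)"
proof (rule aut_groupI)
  show "lift a \<tau> \<in> extensional (flags derived)"
    by (simp add: lift_def)
  have "bij_betw (\<lambda>\<gamma>. \<gamma> \<otimes> a) (carrier G) (carrier G)"
    by (rule bij_betw_byWitness[where f' = "\<lambda>\<gamma>. \<gamma> \<otimes> inv a"]) (auto simp: a G.m_assoc)
  then have "bij_betw (\<lambda>\<gamma>. induced \<tau> (\<gamma> \<otimes> a)) (carrier G) (carrier G)"
    using bij_betw_trans[OF _ induced_bij[OF \<tau>]] by (simp add: comp_def)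
  then have "bij_betw (map_prod \<tau> (\<lambda>\<gamma>. induced \<tau> (\<gamma> \<otimes> a))) (flags derived) (flags derived)"
    using aut_group_bij[OF \<tau>] by (simp add: bij_betw_map_prod)
  then show "bij_betw (lift a \<tau>) (flags derived) (flags derived)"
    by (rule bij_betw_cong[THEN iffD1, rotated]) (auto simp: lift_apply)
next
  fix i X
  assume i: "i < n + 1" and X: "X \<in> flags derived"
  then obtain \<Phi> \<gamma> where X_eq: "X = (\<Phi>, \<gamma>)" and \<Phi>: "\<Phi> \<in> flags K" and \<gamma>: "\<gamma> \<in> carrier G"
    by auto
  show "lift a \<tau> (adj derived i X) = adj derived i (lift a \<tau> X)"
  proof (cases "i = n")
    case True
    have "induced \<tau> (\<xi> (facet_of n K \<Phi>) \<otimes> \<gamma> \<otimes> a) =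
        \<xi> (facet_of n K (\<tau> \<Phi>)) \<otimes> induced \<tau> (\<gamma> \<otimes> a)"
      using a \<gamma> \<Phi> \<tau>
      by (simp add: G.m_assoc xi_facet_closed hom_mult[OF induced_hom] induced_xi
          facet_of_in_facets facet_of_aut)
    then show ?thesis
      using a \<gamma> \<Phi> \<tau> True by (simp add: X_eq lift_apply rn_closed xi_facet_closed aut_rn)
  next
    case False
    then show ?thesis
      using i \<gamma> \<Phi> \<tau> by (simp add: X_eq lift_apply adj_closed aut_group_adj)
  qed
qed

text \<open>Requiring \<open>f\<close> only on one copy of \<open>K\<close> serves two purposes:
  restrictions of automorphisms of the derived maniplex, and automorphisms of a single
  facet.\<close>

lemma ex_lift_on_facet:
  assumes \<gamma>: "\<gamma> \<in> carrier G"
    and closed: "f \<in> flags K \<times> {\<gamma>} \<rightarrow> flags derived"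
    and inj: "inj_on f (flags K \<times> {\<gamma>})"
    and adj: "\<And>i \<Phi>. \<lbrakk>i < n; \<Phi> \<in> flags K\<rbrakk> \<Longrightarrow> f (adj K i \<Phi>, \<gamma>) = adj derived i (f (\<Phi>, \<gamma>))"
  shows "\<exists>a\<in>carrier G. \<exists>\<tau>\<in>carrier (aut_group n K). \<forall>\<Phi>\<in>flags K. lift a \<tau> (\<Phi>, \<gamma>) = f (\<Phi>, \<gamma>)"
proof -
  define h where "h = (\<lambda>\<Phi>. f (\<Phi>, \<gamma>))"
  have h_closed: "h \<in> flags K \<rightarrow> flags derived"
    using closed by (auto simp: h_def)
  obtain \<Phi>\<^sub>0 where \<Phi>\<^sub>0: "\<Phi>\<^sub>0 \<in> flags K"
    using nonempty by blast
  obtain \<Psi>\<^sub>0 g where h0: "h \<Phi>\<^sub>0 = (\<Psi>\<^sub>0, g)" "\<Psi>\<^sub>0 \<in> flags K" and g: "g \<in> carrier G"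
    using h_closed \<Phi>\<^sub>0 by fastforce
  \<comment> \<open>The image of connected \<open>K\<close> is a whole component for the colours
    below \<open>n\<close>, hence a single copy; this makes the group coordinate constantly
    \<open>g\<close> and the map \<open>\<tau>\<close> below surjective.\<close>
  have "h ` component_of {..<n} K \<Phi>\<^sub>0 = component_of {..<n} derived (h \<Phi>\<^sub>0)"
    by (rule component_of_image) (use h_closed \<Phi>\<^sub>0 adj_closed adj in \<open>auto simp: h_def\<close>)
  then have image: "h ` flags K = flags K \<times> {g}"
    using h0 g by (simp add: connected[OF \<Phi>\<^sub>0] component_derived)
  then have h_eq: "h \<Phi> = (fst (h \<Phi>), g)" "fst (h \<Phi>) \<in> flags K" if "\<Phi> \<in> flags K" for \<Phi>
    using that by (metis (no_types, lifting) imageI mem_Sigma_iff prod.collapse singletonD)+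
  define \<tau> where "\<tau> = (\<lambda>\<Phi>\<in>flags K. fst (h \<Phi>))"
  have \<tau>: "\<tau> \<in> carrier (aut_group n K)"
  proof (rule aut_groupI)
    have "inj_on h (flags K)"
      using inj by (auto simp: inj_on_def h_def)
    then have "inj_on \<tau> (flags K)"
      unfolding inj_on_def \<tau>_def using h_eq(1) by (metis restrict_apply')
    moreover have "\<tau> ` flags K = fst ` h ` flags K"
      by (simp add: \<tau>_def image_image)
    ultimately show "bij_betw \<tau> (flags K) (flags K)"
      by (simp add: bij_betw_def image)
  next
    fix i \<Phi>
    assume i: "i < n" and \<Phi>: "\<Phi> \<in> flags K"
    have "h (adj K i \<Phi>) = adj derived i (fst (h \<Phi>), g)"
      using adj[OF i \<Phi>] h_eq(1)[OF \<Phi>] by (simp add: h_def)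
    then show "\<tau> (adj K i \<Phi>) = adj K i (\<tau> \<Phi>)"
      using i \<Phi> by (simp add: \<tau>_def adj_closed)
  qed (simp add: \<tau>_def)
  have \<tau>_apply: "\<tau> \<Phi> = fst (h \<Phi>)" if "\<Phi> \<in> flags K" for \<Phi>
    using that by (simp add: \<tau>_def)
  \<comment> \<open>A lift of \<open>\<tau>\<close> must send \<open>\<gamma>\<close> to
    \<open>g\<close>, so the translation has to take \<open>\<gamma>\<close> to the preimage
    \<open>b\<close> of \<open>g\<close>; hence \<open>inv \<gamma> \<otimes> b\<close>.\<close>
  obtain b where b: "b \<in> carrier G" "induced \<tau> b = g"
    using bij_betw_imp_surj_on[OF induced_bij[OF \<tau>]] g by (metis imageE)
  have "lift (inv \<gamma> \<otimes> b) \<tau> (\<Phi>, \<gamma>) = f (\<Phi>, \<gamma>)" if \<Phi>: "\<Phi> \<in> flags K" for \<Phi>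
  proof -
    have "lift (inv \<gamma> \<otimes> b) \<tau> (\<Phi>, \<gamma>) = (fst (h \<Phi>), g)"
      using \<Phi> b \<gamma> by (simp add: lift_apply \<tau>_apply flip: G.m_assoc)
    then show ?thesis
      using h_eq(1)[OF \<Phi>] by (simp add: h_def)
  qed
  then show ?thesis
    using b \<gamma> \<tau> by (intro bexI[of _ "inv \<gamma> \<otimes> b"] bexI[of _ \<tau>]) auto
qed

lemma ex_lift:
  assumes \<alpha>: "\<alpha> \<in> carrier (aut_group (n + 1) derived)"
  shows "\<exists>a\<in>carrier G. \<exists>\<tau>\<in>carrier (aut_group n K). \<alpha> = lift a \<tau>"
proof -
  \<comment> \<open>First match \<open>\<alpha>\<close> with a lift on the identity copy;
    connectedness extends the agreement to all flags.\<close>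
  have "\<exists>a\<in>carrier G. \<exists>\<tau>\<in>carrier (aut_group n K). \<forall>\<Phi>\<in>flags K. lift a \<tau> (\<Phi>, \<one>) = \<alpha> (\<Phi>, \<one>)"
  proof (rule ex_lift_on_facet)
    show "inj_on \<alpha> (flags K \<times> {\<one>})"
      using aut_group_bij[OF \<alpha>] by (auto simp: bij_betw_def intro: inj_on_subset)
    show "\<alpha> (adj K i \<Phi>, \<one>) = adj derived i (\<alpha> (\<Phi>, \<one>))" if "i < n" "\<Phi> \<in> flags K" for i \<Phi>
      using aut_group_adj[OF \<alpha>, of i "(\<Phi>, \<one>)"] that by simp
  qed (use aut_group_closed[OF \<alpha>] in auto)
  then obtain a \<tau> where a: "a \<in> carrier G" and \<tau>: "\<tau> \<in> carrier (aut_group n K)"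
    and agree: "\<And>\<Phi>. \<Phi> \<in> flags K \<Longrightarrow> lift a \<tau> (\<Phi>, \<one>) = \<alpha> (\<Phi>, \<one>)"
    by blast
  obtain \<Phi>\<^sub>0 where \<Phi>\<^sub>0: "\<Phi>\<^sub>0 \<in> flags K"
    using nonempty by blast
  have "\<alpha> = lift a \<tau>"
  proof (rule extensionalityI)
    fix X
    assume "X \<in> flags derived"
    then have "X \<in> component_of {..<n + 1} derived (\<Phi>\<^sub>0, \<one>)"
      using component_derived_full \<Phi>\<^sub>0 by blast
    then show "\<alpha> X = lift a \<tau> X"
      by (rule component_of_agree[where N = derived])
        (use agree[OF \<Phi>\<^sub>0] aut_group_adj[OF \<alpha>] aut_group_adj[OF lift_aut[OF a \<tau>]] in auto)
  qed (use aut_group_extensional[OF \<alpha>] aut_group_extensional[OF lift_aut[OF a \<tau>]] in auto)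
  then show ?thesis
    using a \<tau> by blast
qed

lemma lift_inject:
  assumes a: "a \<in> carrier G" and b: "b \<in> carrier G"
    and \<sigma>: "\<sigma> \<in> carrier (aut_group n K)" and \<tau>: "\<tau> \<in> carrier (aut_group n K)"
    and eq: "lift a \<sigma> = lift b \<tau>"
  shows "a = b" "\<sigma> = \<tau>"
proof -
  \<comment> \<open>On the identity copy the two coordinates separate the data: flags determine the
    automorphism, and then injectivity of \<open>induced \<tau>\<close> determines the
    translation.\<close>
  have *: "\<sigma> \<Phi> = \<tau> \<Phi> \<and> induced \<sigma> a = induced \<tau> b" if "\<Phi> \<in> flags K" for \<Phi>
    using fun_cong[OF eq, of "(\<Phi>, \<one>)"] that a b by (simp add: lift_apply)
  then show "\<sigma> = \<tau>"
    by (auto intro: extensionalityI[OF aut_group_extensional[OF \<sigma>] aut_group_extensional[OF \<tau>]])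
  then show "a = b"
    using * nonempty induced_bij[OF \<tau>] a b by (auto simp: bij_betw_def inj_on_def)
qed

text \<open>A facet has rank \<open>n + 1 - 1\<close>, that is \<open>n\<close>, and is a copy of
  \<open>K\<close>; \<open>ex_lift_on_facet\<close> at its group element extends each of its
  automorphisms by a lift.\<close>

theorem hereditary_derived: "hereditary (n + 1) derived"
  unfolding hereditary_def
proof (intro conjI ballI)
  show "maniplex (n + 1) derived"
    by (rule maniplex_derived)
next
  fix F \<sigma>
  assume "F \<in> facets (n + 1) derived" and \<sigma>: "\<sigma> \<in> carrier (aut_group (n + 1 - 1) (derived\<lparr>flags := F\<rparr>))"
  then obtain \<gamma> where \<gamma>: "\<gamma> \<in> carrier G" and F: "F = flags K \<times> {\<gamma>}"
    by (auto simp: facets_def facet_of_derived simp del: One_nat_def)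
  have bij: "bij_betw \<sigma> F F"
    using aut_group_bij[OF \<sigma>] by simp
  have "\<exists>a\<in>carrier G. \<exists>\<tau>\<in>carrier (aut_group n K). \<forall>\<Phi>\<in>flags K. lift a \<tau> (\<Phi>, \<gamma>) = \<sigma> (\<Phi>, \<gamma>)"
  proof (rule ex_lift_on_facet)
    show "\<sigma> \<in> flags K \<times> {\<gamma>} \<rightarrow> flags derived"
      using bij_betwE[OF bij] \<gamma> by (force simp: F)
    show "inj_on \<sigma> (flags K \<times> {\<gamma>})"
      using bij by (simp add: bij_betw_def F)
    show "\<sigma> (adj K i \<Phi>, \<gamma>) = adj derived i (\<sigma> (\<Phi>, \<gamma>))" if "i < n" "\<Phi> \<in> flags K" for i \<Phi>
      using aut_group_adj[OF \<sigma>, of i "(\<Phi>, \<gamma>)"] that by (simp add: F)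
  qed (rule \<gamma>)
  then obtain a \<tau> where a: "a \<in> carrier G" and \<tau>: "\<tau> \<in> carrier (aut_group n K)"
    and agree: "\<And>X. X \<in> F \<Longrightarrow> lift a \<tau> X = \<sigma> X"
    by (auto simp: F)
  have "lift a \<tau> ` F = F"
    using bij agree by (simp add: bij_betw_def)
  then show "\<exists>\<alpha>\<in>carrier (aut_group (n + 1) derived). \<alpha> ` F = F \<and> (\<forall>X\<in>F. \<alpha> X = \<sigma> X)"
    using lift_aut[OF a \<tau>] agree by blast
qed

text \<open>
  Automorphisms of \<open>K\<close> act on the right, so \<^const>\<open>induced\<close> is an antihomomorphism into
  \<^term>\<open>AutoGroup G\<close>; inverting it gives the left action.
\<close>

definition action :: "('f \<Rightarrow> 'f) \<Rightarrow> 'g \<Rightarrow> 'g"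
  where "action \<tau> = inv\<^bsub>AutoGroup G\<^esub> (induced \<tau>)"

lemma action_auto: "\<tau> \<in> carrier (aut_group n K) \<Longrightarrow> action \<tau> \<in> auto G"
  using group.inv_closed[OF G.AutoGroup, of "induced \<tau>"]
  by (simp add: action_def induced_auto)

text \<open>This is how \<open>action\<close> is used below: it supplies preimages under
  \<open>induced \<tau>\<close>.\<close>

lemma induced_action:
  assumes \<tau>: "\<tau> \<in> carrier (aut_group n K)" and \<gamma>: "\<gamma> \<in> carrier G"
  shows "induced \<tau> (action \<tau> \<gamma>) = \<gamma>"
proof -
  have "induced \<tau> \<otimes>\<^bsub>AutoGroup G\<^esub> action \<tau> = \<one>\<^bsub>AutoGroup G\<^esub>"
    unfolding action_def using induced_auto[OF \<tau>]
    by (simp add: group.r_inv[OF G.AutoGroup])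
  then have "compose (carrier G) (induced \<tau>) (action \<tau>) = (\<lambda>x\<in>carrier G. x)"
    by (simp add: AutoGroup_mult AutoGroup_one induced_auto action_auto \<tau>)
  from fun_cong[OF this, of \<gamma>] show ?thesis
    by (simp add: compose_eq \<gamma>)
qed

lemma action_hom: "action \<in> hom (aut_group n K) (AutoGroup G)"
proof (rule homI)
  fix \<sigma> \<tau>
  assume \<sigma>: "\<sigma> \<in> carrier (aut_group n K)" and \<tau>: "\<tau> \<in> carrier (aut_group n K)"
  have "induced (\<sigma> \<otimes>\<^bsub>aut_group n K\<^esub> \<tau>) = compose (carrier G) (induced \<tau>) (induced \<sigma>)"
    by (rule extensionalityI[where A = "carrier G"])
      (auto simp: induced_extensional aut_mult_closed \<sigma> \<tau> compose_eq induced_mult)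
  also have "\<dots> = induced \<tau> \<otimes>\<^bsub>AutoGroup G\<^esub> induced \<sigma>"
    by (simp add: AutoGroup_mult induced_auto \<sigma> \<tau>)
  finally show "action (\<sigma> \<otimes>\<^bsub>aut_group n K\<^esub> \<tau>) = action \<sigma> \<otimes>\<^bsub>AutoGroup G\<^esub> action \<tau>"
    unfolding action_def using induced_auto[OF \<sigma>] induced_auto[OF \<tau>]
    by (simp add: group.inv_mult_group[OF G.AutoGroup])
qed (simp add: action_auto)

lemma action_closed: "\<lbrakk>\<tau> \<in> carrier (aut_group n K); \<gamma> \<in> carrier G\<rbrakk> \<Longrightarrow> action \<tau> \<gamma> \<in> carrier G"
  using action_auto by (auto simp: auto_def dest: hom_in_carrier)

text \<open>The translation by \<open>b\<close> takes place after \<open>\<sigma>\<close>; moving it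
  in front replaces \<open>b\<close> by its preimage under \<open>induced \<sigma>\<close>.\<close>

lemma lift_mult:
  assumes a: "a \<in> carrier G" and b: "b \<in> carrier G"
    and \<sigma>: "\<sigma> \<in> carrier (aut_group n K)" and \<tau>: "\<tau> \<in> carrier (aut_group n K)"
  shows "lift (a \<otimes> action \<sigma> b) (\<sigma> \<otimes>\<^bsub>aut_group n K\<^esub> \<tau>) =
    lift a \<sigma> \<otimes>\<^bsub>aut_group (n + 1) derived\<^esub> lift b \<tau>"
  unfolding aut_group_mult[where n = "n + 1"]
proof (rule extensionalityI[where A = "flags derived"])
  fix X
  assume "X \<in> flags derived"
  then obtain \<Phi> \<gamma> where X: "X = (\<Phi>, \<gamma>)" and \<Phi>: "\<Phi> \<in> flags K" and \<gamma>: "\<gamma> \<in> carrier G"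
    by auto
  have "induced (\<sigma> \<otimes>\<^bsub>aut_group n K\<^esub> \<tau>) (\<gamma> \<otimes> (a \<otimes> action \<sigma> b)) =
      induced \<tau> (induced \<sigma> ((\<gamma> \<otimes> a) \<otimes> action \<sigma> b))"
    using a b \<gamma> \<sigma> \<tau> by (simp add: induced_mult action_closed G.m_assoc)
  also have "\<dots> = induced \<tau> (induced \<sigma> (\<gamma> \<otimes> a) \<otimes> b)"
    using a b \<gamma> \<sigma> by (simp add: hom_mult[OF induced_hom] action_closed induced_action)
  finally show "lift (a \<otimes> action \<sigma> b) (\<sigma> \<otimes>\<^bsub>aut_group n K\<^esub> \<tau>) X =
      compose (flags derived) (lift b \<tau>) (lift a \<sigma>) X"
    using a \<Phi> \<gamma> \<sigma>
    by (simp add: X lift_apply compose_eq aut_group_closed induced_closed)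
      (simp add: aut_group_mult compose_eq)
qed (simp_all add: lift_def)

theorem aut_group_derived_iso:
  "aut_group (n + 1) derived \<cong> semidirect_product G (aut_group n K) action"
proof (rule is_iso_by_inverse)
  let ?S = "semidirect_product G (aut_group n K) action"
  \<comment> \<open>\<open>lift\<close> goes from the semidirect product to the automorphism group,
    so the isomorphism is its inverse.\<close>
  show "bij_betw (case_prod lift) (carrier ?S) (carrier (aut_group (n + 1) derived))"
  proof (rule bij_betw_imageI)
    show "inj_on (case_prod lift) (carrier ?S)"
      by (rule inj_onI) (auto simp: semidirect_product_def dest: lift_inject)
    show "case_prod lift ` carrier ?S = carrier (aut_group (n + 1) derived)"
    proof
      show "case_prod lift ` carrier ?S \<subseteq> carrier (aut_group (n + 1) derived)"
        using lift_aut by (auto simp: semidirect_product_def)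
      show "carrier (aut_group (n + 1) derived) \<subseteq> case_prod lift ` carrier ?S"
        using ex_lift by (fastforce simp: semidirect_product_def)
    qed
  qed
  fix x y
  assume "x \<in> carrier ?S" "y \<in> carrier ?S"
  then show "x \<otimes>\<^bsub>?S\<^esub> y \<in> carrier ?S"
    and "case_prod lift (x \<otimes>\<^bsub>?S\<^esub> y) = case_prod lift x \<otimes>\<^bsub>aut_group (n + 1) derived\<^esub> case_prod lift y"
    by (auto simp: semidirect_product_def action_closed aut_mult_closed lift_mult[simplified])
qed

section \<open>Flag orbits and the symmetry type graph\<close>

lemma orbit_of_derived:
  assumes \<Phi>: "\<Phi> \<in> flags K" and \<gamma>: "\<gamma> \<in> carrier G"
  shows "orbit_of (carrier (aut_group (n + 1) derived)) (\<Phi>, \<gamma>) =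
    orbit_of (carrier (aut_group n K)) \<Phi> \<times> carrier G" (is "?L = ?R")
proof
  show "?L \<subseteq> ?R"
    using ex_lift \<Phi> \<gamma> by (fastforce simp: orbit_of_def lift_apply induced_closed)
next
  show "?R \<subseteq> ?L"
  proof clarify
    fix \<Psi> \<delta>
    assume "\<Psi> \<in> orbit_of (carrier (aut_group n K)) \<Phi>" and \<delta>: "\<delta> \<in> carrier G"
    then obtain \<tau> where \<tau>: "\<tau> \<in> carrier (aut_group n K)" "\<Psi> = \<tau> \<Phi>"
      by (auto simp: orbit_of_def)
    \<comment> \<open>With \<open>\<tau>\<close> fixed, the translation is still free; this one
      brings the group coordinate from \<open>\<gamma>\<close> to \<open>\<delta>\<close>.\<close>
    let ?a = "inv \<gamma> \<otimes> action \<tau> \<delta>"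
    have "\<gamma> \<otimes> ?a = action \<tau> \<delta>"
      using \<gamma> \<delta> \<tau> by (simp add: action_closed flip: G.m_assoc)
    then have "(\<Psi>, \<delta>) = lift ?a \<tau> (\<Phi>, \<gamma>)"
      using \<Phi> \<gamma> \<delta> \<tau> by (simp add: lift_apply induced_action)
    moreover have "lift ?a \<tau> \<in> carrier (aut_group (n + 1) derived)"
      by (rule lift_aut) (use \<gamma> \<delta> \<tau> action_closed in auto)
    ultimately show "(\<Psi>, \<delta>) \<in> ?L"
      unfolding orbit_of_def by blast
  qed
qed

text \<open>Every orbit has all of \<open>G\<close> as its second factor, so voltages disappear in
  the quotient and projecting to flags keeps all information.\<close>

theorem symmetry_type_graph_derived_iso:
  "image fst \<in> fg_iso (n + 1) (symmetry_type_graph (n + 1) derived)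
    (quotient_fg (pre_extension n K rn) (carrier (aut_group n K)))"
proof -
  let ?S = "symmetry_type_graph (n + 1) derived"
  let ?orb = "orbit_of (carrier (aut_group n K))"
  let ?Q = "quotient_fg (pre_extension n K rn) (carrier (aut_group n K))"
  have flags_S: "flags ?S = (\<lambda>\<Phi>. ?orb \<Phi> \<times> carrier G) ` flags K"
  proof -
    have "flags ?S = (\<lambda>(\<Phi>, \<gamma>). ?orb \<Phi> \<times> carrier G) ` (flags K \<times> carrier G)"
      unfolding symmetry_type_graph_def quotient_fg_def
      by (auto simp: orbit_of_derived[simplified] intro!: image_cong)
    then show ?thesis
      using G.one_closed by force
  qed
  \<comment> \<open>A nonempty second factor lets the projection recover the first one, which gives
    injectivity.\<close>
  have carrier: "carrier G \<noteq> {}"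
    using G.one_closed by blast
  have flags_Q: "flags ?Q = ?orb ` flags K"
    by (simp add: quotient_fg_def pre_extension_def)
  have "bij_betw (image fst) (flags ?S) (flags ?Q)"
    unfolding flags_S flags_Q
    by (rule bij_betw_imageI) (auto simp: inj_on_def carrier image_image)
  moreover have "fst ` adj ?S i X = adj ?Q i (fst ` X)" if i: "i < n + 1" and X: "X \<in> flags ?S" for i X
  proof -
    obtain \<Phi> where \<Phi>: "\<Phi> \<in> flags K" and X_eq: "X = ?orb \<Phi> \<times> carrier G"
      using X unfolding flags_S by blast
    have orb_flags: "?orb \<Phi> \<subseteq> flags K"
      using \<Phi> by (auto simp: orbit_of_def aut_group_closed)
    have orb_adj: "fst ` orbit_of (carrier (aut_group (n + 1) derived)) (adj derived i (\<Psi>, \<gamma>)) =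
        ?orb (adj (pre_extension n K rn) i \<Psi>)" if "\<Psi> \<in> flags K" "\<gamma> \<in> carrier G" for \<Psi> \<gamma>
    proof (cases "i = n")
      case True
      then show ?thesis
        using that
        by (simp add: orbit_of_derived[simplified] rn_closed xi_facet_closed carrier pre_extension_def)
    next
      case False
      then show ?thesis
        using that i
        by (simp add: orbit_of_derived[simplified] adj_closed carrier pre_extension_def)
    qed
    \<comment> \<open>Quotient adjacency is a union over the orbit; images commute with unions, and
      each projected term depends only on the flag coordinate.\<close>
    have "fst ` adj ?S i X = (\<Union>Y\<in>X. fst ` orbit_of (carrier (aut_group (n + 1) derived)) (adj derived i Y))"
      by (simp add: symmetry_type_graph_def quotient_fg_def image_UN)
    also have "\<dots> = (\<Union>Y\<in>X. ?orb (adj (pre_extension n K rn) i (fst Y)))"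
    proof (rule SUP_cong)
      fix Y
      assume "Y \<in> X"
      then have "fst Y \<in> flags K" "snd Y \<in> carrier G"
        using orb_flags by (auto simp: X_eq)
      from orb_adj[OF this] show "fst ` orbit_of (carrier (aut_group (n + 1) derived)) (adj derived i Y) =
          ?orb (adj (pre_extension n K rn) i (fst Y))"
        by simp
    qed simp
    also have "\<dots> = adj ?Q i (fst ` X)"
      by (simp add: quotient_fg_def)
    finally show ?thesis .
  qed
  ultimately show ?thesis
    by (simp add: fg_iso_def)
qed

end

theorem theorem5p5:
  fixes n :: nat and K :: "'f flag_graph" and rn :: "'f \<Rightarrow> 'f"
    and G :: "('g, 'b) monoid_scheme" and \<xi> :: "'f set \<Rightarrow> 'g"
  assumes "cayley_extender n K rn G \<xi>"
    and "aut_group (n + 1) (pre_extension n K rn) = aut_group n K"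
    and "\<forall>\<tau>\<in>carrier (aut_group n K). \<exists>\<theta>\<in>auto G. \<forall>F\<in>facets n K. \<theta> (\<xi> F) = \<xi> (\<tau> ` F)"
  shows "hereditary (n + 1) (derived_maniplex n K rn G \<xi>)
    \<and> (\<exists>\<phi>\<in>hom (aut_group n K) (AutoGroup G).
        aut_group (n + 1) (derived_maniplex n K rn G \<xi>) \<cong> semidirect_product G (aut_group n K) \<phi>)
    \<and> fg_iso (n + 1) (symmetry_type_graph (n + 1) (derived_maniplex n K rn G \<xi>))
        (quotient_fg (pre_extension n K rn) (carrier (aut_group n K))) \<noteq> {}"
proof -
  have "symmetric_cayley_extender n K rn G \<xi>"
  proof (intro symmetric_cayley_extender.intro symmetric_cayley_extender_axioms.intro)
    show "\<tau> (rn \<Phi>) = rn (\<tau> \<Phi>)" if "\<tau> \<in> carrier (aut_group n K)" "\<Phi> \<in> flags K" for \<tau> \<Phi>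
      \<comment> \<open>By the equality of the two groups, \<open>\<tau>\<close> also preserves
        colour \<open>n\<close> of the pre-extension, which is \<open>rn\<close>.\<close>
      using aut_group_adj[of \<tau> "n + 1" "pre_extension n K rn" n \<Phi>] that
      by (simp only: assms(2)) (simp add: pre_extension_def)
  qed (use assms in auto)
  then interpret symmetric_cayley_extender n K rn G \<xi> .
  show ?thesis
    using hereditary_derived action_hom aut_group_derived_iso symmetry_type_graph_derived_iso by blast
qed

end
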